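(* Let $a\in\mathbb{Z}_{\geq -1}$, let $\rho$ be the largest root of $x^3-ax^2-(a+3)x-1$, let $K=\mathbb{Q}(\rho)$, and assume that $\mathcal{O}_K=\mathbb{Z}[\rho]$. Then the elements $1$, $1+\rho+\rho^2$, and $-v-w\rho+(v+1)\rho^2$, where $v,w$ are integers with $0\leq v\leq a$ and $v(a+2)+1\leq w\leq (v+1)(a+1)$, are, up to multiplication by totally positive units, all the indecomposable elements in $\mathcal{O}_K$. (That is, all these elements are indecomposable, and every indecomposable element of $\mathcal{O}_K$ is the product of one of them and a totally positive unit of $\mathcal{O}_K$.)
   Context: The field $K$ is totally real. An element of $K$ is totally positive if all its images under embeddings $K\hookrightarrow\mathbb{R}$ are positive; $\mathcal{O}_K^+$ is the set of totally positive elements of $\mathcal{O}_K$. An element $\alpha\in\mathcal{O}_K^+$ is indecomposable (in $\mathcal{O}_K$) if it cannot be written as $\alpha=\beta+\gamma$ with $\beta,\gamma\in\mathcal{O}_K^+$. *)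

theory Defs
  imports
    "HOL-Algebra.Generated_Rings"
    "HOL-Algebra.Generated_Fields"
    "HOL-Algebra.Algebraic_Closure_Type"
begin

text \<open>
  Number fields are represented as subsets \<open>K\<close> of the reals; algebraic structure on them is
  inherited from the field of real numbers, viewed as an HOL-Algebra ring.
\<close>

abbreviation real_ring :: "real ring" where
  "real_ring \<equiv> ring_of_type_algebra"

definition ring_of_integers :: "real set \<Rightarrow> real set" where
  "ring_of_integers K = {x \<in> K. algebraic_int x}"

text \<open>
  An element of \<open>ring_hom\<close> is a total function on the reals, only its values on \<open>K\<close> being
  constrained. As \<open>K\<close> is a field, such homomorphisms are automatically injective on \<open>K\<close>.
\<close>

definition real_embeddings :: "real set \<Rightarrow> (real \<Rightarrow> real) set" where
  "real_embeddings K = ring_hom (real_ring\<lparr>carrier := K\<rparr>) real_ring"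

definition totally_positive :: "real set \<Rightarrow> real \<Rightarrow> bool" where
  "totally_positive K x \<longleftrightarrow> x \<in> K \<and> (\<forall>\<sigma> \<in> real_embeddings K. \<sigma> x > 0)"

definition totally_positive_integers :: "real set \<Rightarrow> real set" where
  "totally_positive_integers K = {x \<in> ring_of_integers K. totally_positive K x}"

definition indecomposable :: "real set \<Rightarrow> real \<Rightarrow> bool" where
  "indecomposable K \<alpha> \<longleftrightarrow>
     \<alpha> \<in> totally_positive_integers K \<and>
     \<not> (\<exists>\<beta> \<in> totally_positive_integers K. \<exists>\<gamma> \<in> totally_positive_integers K. \<alpha> = \<beta> + \<gamma>)"

definition totally_positive_units :: "real set \<Rightarrow> real set" where
  "totally_positive_units K =
     {u \<in> Units (real_ring\<lparr>carrier := ring_of_integers K\<rparr>). totally_positive K u}"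

definition simplest_cubic_representatives :: "int \<Rightarrow> real \<Rightarrow> real set" where
  "simplest_cubic_representatives a \<rho> =
     {1, 1 + \<rho> + \<rho>^2} \<union>
     {- of_int v - of_int w * \<rho> + (of_int v + 1) * \<rho>^2 | v w :: int.
        0 \<le> v \<and> v \<le> a \<and> v * (a + 2) + 1 \<le> w \<and> w \<le> (v + 1) * (a + 1)}"

end

(*
  In the basis 1, rho, rho^2 the forms x + z and 2x - y + 2z are traces against totally positive
  elements of the inverse different, hence positive integers on totally positive
  integers. On the cone C1 = <1, rho^2, (1+rho)^2> all generators have 2x - y + 2z = 2, and on
  C2 = <1, rho^2, rho^2 (1+rho)^-2> all generators have x + z = 1. The inequality comparing the
  values of 2(x + z) and 2x - y + 2z across a wall between translates of C1 and C2 is exactly the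
  inequality defining that wall. So an element whose value is minimal among all its multiples by
  totally positive units satisfies all the wall inequalities and lies in C1 or C2; no fundamental
  domain theorem and no knowledge of the full unit group is needed. The lattice points of the two
  cones are then elementary: C1 has index 2, and C2 is a cone over a lattice triangle.
  Elements with x + z = 1 are indecomposable since x + z is positive and integral; for
  1 + rho + rho^2 the three unit translates of x + z on the walls of C1 all take the value 2,
  which would force a summand to be half of it.
*)
theory Submission
  imports Defs
begin

section \<open>The reals as an HOL-Algebra ring\<close>

lemma real_ring_simps [simp]:
  "carrier real_ring = UNIV" "x \<oplus>\<^bsub>real_ring\<^esub> y = x + y" "x \<otimes>\<^bsub>real_ring\<^esub> y = x * y"
  "\<one>\<^bsub>real_ring\<^esub> = 1" "\<zero>\<^bsub>real_ring\<^esub> = 0"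
  by (simp_all add: ring_of_type_algebra_def)

interpretation reals: ring real_ring
  by (rule ring_from_type_algebra)

lemma real_ring_a_inv [simp]: "\<ominus>\<^bsub>real_ring\<^esub> x = - x"
  using reals.minus_equality[of "- x" x] by simp

lemma real_ring_m_inv [simp]: "x \<noteq> 0 \<Longrightarrow> inv\<^bsub>real_ring\<^esub> x = 1 / x"
  using comm_monoid.comm_inv_char[OF cring.axioms(2)[OF cring_from_type_algebra], of x "1 / x"] by simp

lemma generate_ring_of_int:
  "of_int n \<in> generate_ring real_ring H"
proof (induction n rule: int_induct[where k = 0])
  case base
  show ?case using reals.zero_in_generate by simp
next
  case (step1 i)
  then show ?case using generate_ring.eng_add[OF step1(2) generate_ring.one] by simp
next
  case (step2 i)
  then show ?case
    using generate_ring.eng_add[OF step2(2) generate_ring.a_inv[OF generate_ring.one]] by simp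
qed

section \<open>Integral coordinates, the norm form and irreducibility\<close>

text \<open>The root is a parameter, so that one integer triple describes an element together with
  all its conjugates.\<close>

definition quad :: "real \<Rightarrow> int \<Rightarrow> int \<Rightarrow> int \<Rightarrow> real" where
  "quad r x y z = of_int x + of_int y * r + of_int z * r\<^sup>2"

lemma quad_add: "quad r x y z + quad r x' y' z' = quad r (x + x') (y + y') (z + z')"
  by (simp add: quad_def algebra_simps)

lemma quad_uminus: "- quad r x y z = quad r (- x) (- y) (- z)"
  by (simp add: quad_def algebra_simps)

lemma quad_scale: "of_int d * quad r x y z = quad r (d * x) (d * y) (d * z)"
  by (simp add: quad_def algebra_simps)

lemma quad_0 [simp]: "quad r 0 0 0 = 0" and quad_const [simp]: "quad r n 0 0 = of_int n"
  and quad_root [simp]: "quad r 0 1 0 = r"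
  by (simp_all add: quad_def)

text \<open>The norm of \<open>x + y*r + z*r^2\<close>, the product of its values at the three roots
  of the cubic.\<close>

definition cubic_norm :: "int \<Rightarrow> int \<Rightarrow> int \<Rightarrow> int \<Rightarrow> int" where
  "cubic_norm a x y z =
     a^2*x^2*z - a^2*x*y*z + a^2*x*z^2 + a*x^2*y + 2*a*x^2*z - a*x*y^2 - 3*a*x*y*z + 4*a*x*z^2
     + a*y^2*z - a*y*z^2 + x^3 + 6*x^2*z - 3*x*y^2 - 3*x*y*z + 9*x*z^2 + y^3 - 3*y*z^2 + z^3"

text \<open>The cubic is odd at 0 and at 1, hence irreducible over the field with two elements, so
  its norm form vanishes there only at the origin.\<close>

lemma even_cubic_norm:
  assumes "even (cubic_norm a x y z)"
  shows "even x \<and> even y \<and> even z"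
  using assms unfolding cubic_norm_def
  by (cases "even x"; cases "even y"; cases "even z"; cases "even a") simp_all

text \<open>Irreducibility of the cubic, by descent: modulo 2 the norm form of the cubic is anisotropic.\<close>

lemma cubic_norm_eq_0:
  assumes "cubic_norm a x y z = 0"
  shows "x = 0 \<and> y = 0 \<and> z = 0"
  using assms
proof (induction "nat (\<bar>x\<bar> + \<bar>y\<bar> + \<bar>z\<bar>)" arbitrary: x y z rule: less_induct)
  case less
  obtain x' y' z' where [simp]: "x = 2 * x'" "y = 2 * y'" "z = 2 * z'"
    using even_cubic_norm[of a x y z] less.prems by (auto elim!: evenE)
  have "8 * cubic_norm a x' y' z' = cubic_norm a x y z"
    by (simp add: cubic_norm_def power2_eq_square power3_eq_cube algebra_simps)
  then have 0: "cubic_norm a x' y' z' = 0"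
    using less.prems by linarith
  show ?case
  proof (rule ccontr)
    assume "\<not> ?thesis"
    then have "nat (\<bar>x'\<bar> + \<bar>y'\<bar> + \<bar>z'\<bar>) < nat (\<bar>x\<bar> + \<bar>y\<bar> + \<bar>z\<bar>)" by auto
    from less.hyps[OF this 0] \<open>\<not> ?thesis\<close> show False by simp
  qed
qed

definition cubic_root :: "int \<Rightarrow> real \<Rightarrow> bool" where
  "cubic_root a r \<longleftrightarrow> r^3 - of_int a * r^2 - (of_int a + 3) * r - 1 = 0"

lemma quad_mult:
  assumes "cubic_root a r"
  shows "quad r x y z * quad r u v w =
    quad r (x*u + y*w + z*v + a*z*w)
      (x*v + y*u + (a + 3)*(y*w + z*v) + (a^2 + 3*a + 1)*z*w)
      (x*w + y*v + z*u + a*(y*w + z*v) + (a^2 + a + 3)*z*w)"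
proof -
  \<comment> \<open>Polynomial division of the formal product by the cubic: the quotient is
    \<open>z*w*r + (y*w + z*v + a*z*w)\<close>.\<close>
  have "quad r x y z * quad r u v w =
    quad r (x*u + y*w + z*v + a*z*w)
      (x*v + y*u + (a + 3)*(y*w + z*v) + (a^2 + 3*a + 1)*z*w)
      (x*w + y*v + z*u + a*(y*w + z*v) + (a^2 + a + 3)*z*w)
    + (r^3 - of_int a * r^2 - (of_int a + 3) * r - 1) * of_int (z*w) * r
    + (r^3 - of_int a * r^2 - (of_int a + 3) * r - 1) * of_int (y*w + z*v + a*z*w)"
    by (simp add: quad_def algebra_simps power2_eq_square power3_eq_cube)
  then show ?thesis
    using assms by (simp add: cubic_root_def)
qed

lemma quad_mult_adjugate:
  "\<exists>u v w. \<forall>r. cubic_root a r \<longrightarrow> quad r x y z * quad r u v w = of_int (cubic_norm a x y z)"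
  \<comment> \<open>The witnesses are cofactors of the multiplication matrix, that is, the
    coordinates of the product of the other two conjugates.\<close>
  by (rule exI[of _ "a^2*x*z - a^2*y*z + a^2*z^2 + a*x*y + 2*a*x*z - a*y^2 - 3*a*y*z + 5*a*z^2
        + x^2 + 6*x*z - 3*y^2 - y*z + 9*z^2"],
      rule exI[of _ "a^2*z^2 - a^2*y*z - a*y^2 + 3*a*z^2 - x*y + z^2"],
      rule exI[of _ "a*y*z - a*z^2 - x*z + y^2 - 3*z^2"], intro allI impI,
      subst quad_mult, assumption, subst quad_const[symmetric],
      rule arg_cong3[where f = "quad _"])
     (simp_all add: cubic_norm_def algebra_simps power2_eq_square power3_eq_cube)

text \<open>A vanishing value forces the norm to vanish. Hence 1, \<open>r\<close>,
  \<open>r^2\<close> are linearly independent over the rationals for each root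
  \<open>r\<close>.\<close>

lemma quad_eq_0:
  assumes "cubic_root a r" "quad r x y z = 0"
  shows "x = 0 \<and> y = 0 \<and> z = 0"
  using quad_mult_adjugate[of a x y z] assms cubic_norm_eq_0[of a x y z] by auto

lemma quad_eq_iff:
  assumes "cubic_root a r"
  shows "quad r x y z = quad r x' y' z' \<longleftrightarrow> x = x' \<and> y = y' \<and> z = z'"
  using quad_eq_0[OF assms, of "x - x'" "y - y'" "z - z'"]
  by (auto simp: quad_def algebra_simps)

section \<open>The field, its integers and its embeddings\<close>

text \<open>Positivity of \<open>\<rho>\<close> encodes that it is the largest root: the other two,
  given in \<open>conjugate_roots\<close>, are then negative.\<close>

locale simplest_cubic_field =
  fixes a :: int and \<rho> :: real and K :: "real set"
  assumes a_ge: "a \<ge> -1"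
    and root: "cubic_root a \<rho>"
    and root_pos: "\<rho> > 0"
    and field_eq: "K = generate_field real_ring {\<rho>}"
    and maximal_order: "ring_of_integers K = generate_ring real_ring {\<rho>}"
begin

lemma field_closed:
  shows "1 \<in> K" "\<rho> \<in> K"
    and "s \<in> K \<Longrightarrow> t \<in> K \<Longrightarrow> s + t \<in> K"
    and "s \<in> K \<Longrightarrow> t \<in> K \<Longrightarrow> s * t \<in> K"
    and "s \<in> K \<Longrightarrow> - s \<in> K"
    and "s \<in> K \<Longrightarrow> t \<in> K \<Longrightarrow> s - t \<in> K"
proof -
  show "1 \<in> K" "\<rho> \<in> K"
    using generate_field.one[of real_ring "{\<rho>}"] generate_field.incl[of \<rho> "{\<rho>}" real_ring]
    by (simp_all add: field_eq)
  show add: "s + t \<in> K" if "s \<in> K" "t \<in> K" for s t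
    using generate_field.eng_add[of s real_ring "{\<rho>}" t] that by (simp add: field_eq)
  show "s * t \<in> K" if "s \<in> K" "t \<in> K" for s t
    using generate_field.eng_mult[of s real_ring "{\<rho>}" t] that by (simp add: field_eq)
  show minus: "- s \<in> K" if "s \<in> K" for s
    using generate_field.a_inv[of s real_ring "{\<rho>}"] that by (simp add: field_eq)
  show "s - t \<in> K" if "s \<in> K" "t \<in> K" for s t
    using add[OF _ minus, of s t] that by simp
qed

lemma field_of_int: "of_int n \<in> K"
proof (induction n rule: int_induct[where k = 0])
  case base
  show ?case using field_closed(6)[OF field_closed(1) field_closed(1)] by simp
qed (use field_closed in simp_all)

lemma integers_iff: "t \<in> ring_of_integers K \<longleftrightarrow> (\<exists>x y z. t = quad \<rho> x y z)"
proof
  assume "t \<in> ring_of_integers K"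
  then have "t \<in> generate_ring real_ring {\<rho>}" by (simp add: maximal_order)
  then show "\<exists>x y z. t = quad \<rho> x y z"
  proof induction
    case one
    show ?case by (intro exI[of _ 1] exI[of _ 0]) simp
  next
    case (incl h)
    then show ?case by (intro exI[of _ 0] exI[of _ 1]) simp
  next
    case (a_inv h)
    then obtain x y z where "h = quad \<rho> x y z" by blast
    then show ?case by (simp add: quad_uminus) blast
  next
    case (eng_add h1 h2)
    then obtain x y z x' y' z' where "h1 = quad \<rho> x y z" "h2 = quad \<rho> x' y' z'" by blast
    then show ?case by (simp add: quad_add) blast
  next
    case (eng_mult h1 h2)
    then obtain x y z x' y' z' where "h1 = quad \<rho> x y z" "h2 = quad \<rho> x' y' z'" by blast
    then show ?case by (simp add: quad_mult[OF root]) blast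
  qed
next
  have \<rho>: "\<rho> \<in> generate_ring real_ring {\<rho>}" by (simp add: generate_ring.incl)
  assume "\<exists>x y z. t = quad \<rho> x y z"
  then show "t \<in> ring_of_integers K"
    using generate_ring.eng_add[of _ real_ring "{\<rho>}"] generate_ring.eng_mult[of _ real_ring "{\<rho>}"]
      generate_ring_of_int \<rho>
    unfolding maximal_order quad_def power2_eq_square real_ring_simps by metis
qed

lemma quad_in_integers: "quad \<rho> x y z \<in> ring_of_integers K"
  using integers_iff by blast

lemma quad_in_field: "quad \<rho> x y z \<in> K"
  using quad_in_integers by (simp add: ring_of_integers_def)

text \<open>Such fractions are closed under inversion because the adjugate turns the denominator
  into the norm, a nonzero integer.\<close>

lemma field_imp_quad:
  assumes "t \<in> K"
  shows "\<exists>x y z d. d \<noteq> 0 \<and> t = quad \<rho> x y z / of_int d"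
  using assms unfolding field_eq
proof induction
  case one
  show ?case by (rule exI[of _ 1], rule exI[of _ 0], rule exI[of _ 0], rule exI[of _ 1]) simp
next
  case (incl h)
  then show ?case by (intro exI[of _ 0] exI[of _ 1] exI[of _ 0] exI[of _ 1]) simp
next
  case (a_inv h)
  then obtain x y z d where "d \<noteq> 0" "h = quad \<rho> x y z / of_int d" by blast
  then have "- h = quad \<rho> (- x) (- y) (- z) / of_int d" by (simp flip: quad_uminus)
  with \<open>d \<noteq> 0\<close> show ?case by auto
next
  case (m_inv h)
  then obtain x y z d where h: "d \<noteq> 0" "h = quad \<rho> x y z / of_int d" by blast
  obtain u v w where uvw: "quad \<rho> x y z * quad \<rho> u v w = of_int (cubic_norm a x y z)"
    using quad_mult_adjugate root by blast
  have "h \<noteq> 0" using m_inv by simp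
  then have "quad \<rho> x y z \<noteq> 0" using h by simp
  then have "cubic_norm a x y z \<noteq> 0" using cubic_norm_eq_0[of a x y z] by auto
  moreover from this have "quad \<rho> u v w \<noteq> 0" using uvw by auto
  then have "1 / h = quad \<rho> (d * u) (d * v) (d * w) / of_int (cubic_norm a x y z)"
    unfolding h(2) quad_scale[symmetric] uvw[symmetric]
    using \<open>quad \<rho> x y z \<noteq> 0\<close> h(1) by simp
  ultimately show ?case using \<open>h \<noteq> 0\<close> unfolding real_ring_m_inv[OF \<open>h \<noteq> 0\<close>] by metis
next
  case (eng_add h1 h2)
  from eng_add.IH obtain x y z d where h1: "d \<noteq> 0" "h1 = quad \<rho> x y z / of_int d" by metis
  from eng_add.IH obtain x' y' z' d' where h2: "d' \<noteq> 0" "h2 = quad \<rho> x' y' z' / of_int d'" by metis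
  from h1 h2 have "d * d' \<noteq> 0" "h1 + h2 = quad \<rho> (d' * x + d * x') (d' * y + d * y') (d' * z + d * z')
      / of_int (d * d')"
    by (simp_all add: add_frac_eq flip: quad_scale quad_add)
  then show ?case unfolding real_ring_simps by metis
next
  case (eng_mult h1 h2)
  from eng_mult.IH obtain x y z d where h1: "d \<noteq> 0" "h1 = quad \<rho> x y z / of_int d" by metis
  from eng_mult.IH obtain x' y' z' d' where h2: "d' \<noteq> 0" "h2 = quad \<rho> x' y' z' / of_int d'" by metis
  from h1 h2 have "d * d' \<noteq> 0" "h1 * h2 = (quad \<rho> x y z * quad \<rho> x' y' z') / of_int (d * d')"
    by simp_all
  then show ?case unfolding real_ring_simps quad_mult[OF root] by metis
qed

text \<open>For a root \<open>r\<close>, the embedding of \<open>K\<close> that sends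
  \<open>\<rho>\<close> to \<open>r\<close>. Elements of \<open>K\<close> are bare reals, so their
  coordinates are recovered by a definite description; linear independence makes it well
  defined.\<close>

definition conjugate :: "real \<Rightarrow> real \<Rightarrow> real" where
  "conjugate r t = (THE s. \<exists>x y z d. d \<noteq> 0 \<and> t = quad \<rho> x y z / of_int d \<and> s = quad r x y z / of_int d)"

lemma conjugate_quad_divide:
  assumes "d \<noteq> 0"
  shows "conjugate r (quad \<rho> x y z / of_int d) = quad r x y z / of_int d"
  unfolding conjugate_def
proof (rule the_equality)
  fix s
  assume "\<exists>x' y' z' d'. d' \<noteq> 0 \<and> quad \<rho> x y z / of_int d = quad \<rho> x' y' z' / of_int d'
    \<and> s = quad r x' y' z' / of_int d'"
  then obtain x' y' z' d' where d': "d' \<noteq> 0" and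
    eq: "quad \<rho> x y z / of_int d = quad \<rho> x' y' z' / of_int d'" and s: "s = quad r x' y' z' / of_int d'"
    by blast
  have "of_int d' * quad \<rho> x y z = of_int d * quad \<rho> x' y' z'"
    using eq assms d' by (simp add: field_simps)
  then have "d' * x = d * x' \<and> d' * y = d * y' \<and> d' * z = d * z'"
    by (simp only: quad_scale quad_eq_iff[OF root])
  then have "of_int d' * quad r x y z = of_int d * quad r x' y' z'"
    by (simp only: quad_scale)
  then have "of_int d' * quad r x y z = of_int d' * (of_int d * s)"
    using s d' by simp
  then show "s = quad r x y z / of_int d"
    using assms d' by simp
qed (use assms in blast)

lemma conjugate_quad: "conjugate r (quad \<rho> x y z) = quad r x y z"
  using conjugate_quad_divide[of 1] by simp

lemma conjugate_in_real_embeddings: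
  assumes r: "cubic_root a r"
  shows "conjugate r \<in> real_embeddings K"
  unfolding real_embeddings_def
proof (rule ring_hom_memI, goal_cases)
  case (2 s t)
  then have "s \<in> K" "t \<in> K" by simp_all
  then obtain x y z d x' y' z' d' where *: "d \<noteq> 0" "s = quad \<rho> x y z / of_int d"
    "d' \<noteq> 0" "t = quad \<rho> x' y' z' / of_int d'" using field_imp_quad by metis
  then have "d * d' \<noteq> 0" "s * t = (quad \<rho> x y z * quad \<rho> x' y' z') / of_int (d * d')"
    by simp_all
  then have "conjugate r (s * t) = (quad r x y z * quad r x' y' z') / of_int (d * d')"
    unfolding quad_mult[OF root] quad_mult[OF r] by (simp only: conjugate_quad_divide not_False_eq_True)
  also have "\<dots> = conjugate r s * conjugate r t"
    using * by (simp add: conjugate_quad_divide)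
  finally show ?case by simp
next
  case (3 s t)
  then have "s \<in> K" "t \<in> K" by simp_all
  then obtain x y z d x' y' z' d' where *: "d \<noteq> 0" "s = quad \<rho> x y z / of_int d"
    "d' \<noteq> 0" "t = quad \<rho> x' y' z' / of_int d'" using field_imp_quad by metis
  then have "d * d' \<noteq> 0" "s + t = quad \<rho> (d' * x + d * x') (d' * y + d * y') (d' * z + d * z')
      / of_int (d * d')"
    by (simp_all add: add_frac_eq flip: quad_scale quad_add)
  then have "conjugate r (s + t) = quad r (d' * x + d * x') (d' * y + d * y') (d' * z + d * z')
      / of_int (d * d')"
    by (simp only: conjugate_quad_divide not_False_eq_True)
  also have "\<dots> = conjugate r s + conjugate r t"
    using * by (simp add: conjugate_quad_divide add_frac_eq flip: quad_scale quad_add)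
  finally show ?case by simp
next
  case 4
  show ?case using conjugate_quad[of r 1 0 0] by simp
qed simp

lemma embedding_mult:
  assumes "\<sigma> \<in> real_embeddings K" "s \<in> K" "t \<in> K"
  shows "\<sigma> (s * t) = \<sigma> s * \<sigma> t"
  using ring_hom_mult[OF assms(1)[unfolded real_embeddings_def], of s t] assms by simp

lemma embedding_one:
  assumes "\<sigma> \<in> real_embeddings K"
  shows "\<sigma> 1 = 1"
  using ring_hom_one[OF assms[unfolded real_embeddings_def]] by simp

lemma embedding_quad:
  assumes \<sigma>: "\<sigma> \<in> real_embeddings K"
  shows "\<sigma> (quad \<rho> x y z) = quad (\<sigma> \<rho>) x y z" "cubic_root a (\<sigma> \<rho>)"
proof -
  note mult = embedding_mult[OF \<sigma>] and one = embedding_one[OF \<sigma>]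
  have add: "\<sigma> (s + t) = \<sigma> s + \<sigma> t" if "s \<in> K" "t \<in> K" for s t
    using ring_hom_add[OF \<sigma>[unfolded real_embeddings_def], of s t] that by simp
  have zero: "\<sigma> 0 = 0"
    using add[of 0 0] field_of_int[of 0] by simp
  have diff: "\<sigma> (s - t) = \<sigma> s - \<sigma> t" if "s \<in> K" "t \<in> K" for s t
    using add[of "s - t" t] field_closed(6) that by simp
  have int: "\<sigma> (of_int n) = of_int n" for n
    by (induction n rule: int_induct[where k = 0])
      (simp_all add: zero add diff one field_of_int field_closed)
  show quad: "\<sigma> (quad \<rho> x y z) = quad (\<sigma> \<rho>) x y z" for x y z
    by (simp add: quad_def add mult int field_of_int field_closed power2_eq_square)
  \<comment> \<open>The cubic equation as an identity between elements of \<open>K\<close>, to which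
    the embedding can be applied.\<close>
  have "quad \<rho> 0 0 1 * \<rho> = quad \<rho> 1 (a + 3) a"
    using root by (simp add: cubic_root_def quad_def power2_eq_square power3_eq_cube)
  then have "\<sigma> (quad \<rho> 0 0 1) * \<sigma> \<rho> = \<sigma> (quad \<rho> 1 (a + 3) a)"
    by (metis mult quad_in_field field_closed(2))
  then show "cubic_root a (\<sigma> \<rho>)"
    unfolding quad by (simp add: cubic_root_def quad_def power2_eq_square power3_eq_cube)
qed

section \<open>Total positivity in coordinates\<close>

definition tot_pos :: "int \<Rightarrow> int \<Rightarrow> int \<Rightarrow> bool" where
  "tot_pos x y z \<longleftrightarrow> (\<forall>r. cubic_root a r \<longrightarrow> quad r x y z > 0)"

text \<open>Embeddings correspond to real roots: each root \<open>r\<close> gives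
  \<open>conjugate r\<close>, and each embedding sends \<open>\<rho>\<close> to a root.\<close>

lemma totally_positive_quad: "totally_positive K (quad \<rho> x y z) \<longleftrightarrow> tot_pos x y z"
  unfolding totally_positive_def tot_pos_def
  using embedding_quad conjugate_in_real_embeddings conjugate_quad quad_in_field by metis

lemma totally_positive_integers_iff:
  "t \<in> totally_positive_integers K \<longleftrightarrow> (\<exists>x y z. t = quad \<rho> x y z \<and> tot_pos x y z)"
  unfolding totally_positive_integers_def mem_Collect_eq integers_iff
  using totally_positive_quad by blast

lemma indecomposable_quad:
  "indecomposable K (quad \<rho> x y z) \<longleftrightarrow> tot_pos x y z \<and>
    \<not> (\<exists>x' y' z'. tot_pos x' y' z' \<and> tot_pos (x - x') (y - y') (z - z'))"
proof -
  have "(\<exists>\<beta> \<in> totally_positive_integers K. \<exists>\<gamma> \<in> totally_positive_integers K. quad \<rho> x y z = \<beta> + \<gamma>)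
    \<longleftrightarrow> (\<exists>x' y' z' x'' y'' z''. tot_pos x' y' z' \<and> tot_pos x'' y'' z'' \<and>
          quad \<rho> x y z = quad \<rho> x' y' z' + quad \<rho> x'' y'' z'')"
    using totally_positive_integers_iff by metis
  also have "\<dots> \<longleftrightarrow> (\<exists>x' y' z'. tot_pos x' y' z' \<and> tot_pos (x - x') (y - y') (z - z'))"
    unfolding quad_add quad_eq_iff[OF root]
    by (metis add_diff_cancel_left' add_diff_eq)
  finally show ?thesis
    using totally_positive_quad
    by (auto simp: indecomposable_def totally_positive_integers_def quad_in_integers)
qed


section \<open>Totally positive units\<close>

lemma integers_mult:
  assumes "s \<in> ring_of_integers K" "t \<in> ring_of_integers K"
  shows "s * t \<in> ring_of_integers K"
proof -
  obtain x y z u v w where "s = quad \<rho> x y z" "t = quad \<rho> u v w"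
    using assms integers_iff by metis
  then show ?thesis
    by (simp add: quad_mult[OF root] quad_in_integers)
qed

lemma integers_in_field: "t \<in> ring_of_integers K \<Longrightarrow> t \<in> K"
  by (simp add: ring_of_integers_def)

lemma totally_positive_integers_mult:
  assumes "s \<in> totally_positive_integers K" "t \<in> totally_positive_integers K"
  shows "s * t \<in> totally_positive_integers K"
  using assms
  by (auto simp: totally_positive_integers_def totally_positive_def integers_mult integers_in_field
      field_closed embedding_mult)

lemma totally_positive_units_iff:
  "u \<in> totally_positive_units K \<longleftrightarrow>
    u \<in> totally_positive_integers K \<and> (\<exists>v \<in> ring_of_integers K. u * v = 1)"
  by (auto simp: totally_positive_units_def totally_positive_integers_def Units_def mult.commute)

lemma unit_nonzero: "u \<in> totally_positive_units K \<Longrightarrow> u \<noteq> 0"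
  by (auto simp: totally_positive_units_iff)

lemma units_mult:
  assumes "u \<in> totally_positive_units K" "v \<in> totally_positive_units K"
  shows "u * v \<in> totally_positive_units K"
proof -
  obtain u' v' where "u' \<in> ring_of_integers K" "v' \<in> ring_of_integers K" "u * u' = 1" "v * v' = 1"
    using assms totally_positive_units_iff by metis
  then have "u' * v' \<in> ring_of_integers K" "(u * v) * (u' * v') = 1"
    by (simp_all add: integers_mult ac_simps)
  then show ?thesis
    using assms totally_positive_integers_mult by (auto simp: totally_positive_units_iff)
qed

lemma units_divide:
  assumes "u \<in> totally_positive_units K"
  shows "1 / u \<in> totally_positive_units K"
proof -
  obtain v where v: "v \<in> ring_of_integers K" "u * v = 1"
    using assms totally_positive_units_iff by metis
  have "\<sigma> v > 0" if \<sigma>: "\<sigma> \<in> real_embeddings K" for \<sigma>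
  proof -
    have "\<sigma> u > 0" "u \<in> K"
      using assms \<sigma> by (auto simp: totally_positive_units_def totally_positive_def)
    moreover from this have "\<sigma> u * \<sigma> v = 1"
      using embedding_mult[OF \<sigma>, of u v] embedding_one[OF \<sigma>] v integers_in_field by simp
    ultimately show ?thesis
      by (metis zero_less_mult_pos zero_less_one)
  qed
  moreover have "1 / u = v"
    using v(2) unit_nonzero[OF assms] by (simp add: field_simps)
  ultimately show ?thesis
    using v assms
    by (auto simp: totally_positive_units_iff totally_positive_integers_def totally_positive_def
        integers_in_field mult.commute intro!: bexI[of _ u])
qed

text \<open>Embeddings do not vanish on units, so they are positive on their squares. This is the
  source of the explicit units below.\<close>

lemma square_in_units:
  assumes "s \<in> ring_of_integers K" "t \<in> ring_of_integers K" "s * t = 1"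
  shows "s * s \<in> totally_positive_units K"
proof -
  have "\<sigma> (s * s) > 0" if \<sigma>: "\<sigma> \<in> real_embeddings K" for \<sigma>
  proof -
    have "\<sigma> s * \<sigma> t = 1"
      using embedding_mult[OF \<sigma>, of s t] embedding_one[OF \<sigma>] assms integers_in_field by simp
    then have "\<sigma> s \<noteq> 0" by auto
    then show ?thesis
      using embedding_mult[OF \<sigma>, of s s] assms integers_in_field
      by (simp flip: power2_eq_square)
  qed
  moreover have "(s * s) * (t * t) = 1"
    using assms(3) by (metis mult.assoc mult.left_commute mult.right_neutral)
  ultimately show ?thesis
    using assms
    by (auto simp: totally_positive_units_iff totally_positive_integers_def totally_positive_def
        integers_in_field integers_mult field_closed intro!: bexI[of _ "t * t"])
qed

lemma indecomposable_mult_unit: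
  assumes "indecomposable K \<alpha>" "u \<in> totally_positive_units K"
  shows "indecomposable K (u * \<alpha>)"
proof -
  have u: "u \<in> totally_positive_integers K" "1 / u \<in> totally_positive_integers K"
    using assms units_divide totally_positive_units_iff by blast+
  have "\<alpha> = 1 / u * \<beta> + 1 / u * \<gamma>" if "u * \<alpha> = \<beta> + \<gamma>" for \<beta> \<gamma>
    using that unit_nonzero[OF assms(2)] by (simp add: field_simps)
  then show ?thesis
    using assms(1) u totally_positive_integers_mult unfolding indecomposable_def by metis
qed

lemma tot_pos_mult_unit:
  assumes "u \<in> totally_positive_units K" "u * quad \<rho> x y z = quad \<rho> x' y' z'" "tot_pos x y z"
  shows "tot_pos x' y' z'"
  using assms totally_positive_integers_mult[of u "quad \<rho> x y z"]
  by (simp add: totally_positive_units_iff totally_positive_integers_def quad_in_integers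
      totally_positive_quad)

lemma tot_pos_unit:
  assumes "quad \<rho> x y z \<in> totally_positive_units K"
  shows "tot_pos x y z"
  using assms by (simp add: totally_positive_units_def totally_positive_quad)

text \<open>
  Apart from \<open>1\<close>, the elements are \<open>\<rho>\<^sup>2\<close>, \<open>(1 + \<rho>)\<^sup>2\<close>, \<open>(1 + \<rho>)\<^sup>-\<^sup>2\<close>, \<open>\<rho>\<^sup>2 (1 + \<rho>)\<^sup>-\<^sup>2\<close>
  and \<open>\<rho>\<^sup>-\<^sup>2 (1 + \<rho>)\<^sup>2\<close>.
\<close>

lemma unit_elements:
  shows "quad \<rho> 1 0 0 \<in> totally_positive_units K"
    and "quad \<rho> 0 0 1 \<in> totally_positive_units K"
    and "quad \<rho> 1 2 1 \<in> totally_positive_units K"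
    and "quad \<rho> (2 - a) (- (a^2 + a + 1)) a \<in> totally_positive_units K"
    and "quad \<rho> (- (a + 1)) (- (a^2 + 3*a + 3)) (a + 2) \<in> totally_positive_units K"
    and "quad \<rho> (a^2 + 3*a + 4) (a^2 + a + 1) (- (a + 1)) \<in> totally_positive_units K"
proof -
  \<comment> \<open>The inverses come from dividing the cubic by \<open>x\<close> and by
    \<open>x + 1\<close>: its values at 0 and -1 are -1 and 1.\<close>
  have r: "quad \<rho> 0 1 0 * quad \<rho> (- (a + 3)) (- a) 1 = 1"
    and s: "quad \<rho> 1 1 0 * quad \<rho> 2 (a + 1) (- 1) = 1"
    using quad_mult[OF root, of 0 1 0 "- (a + 3)" "- a" 1]
      quad_mult[OF root, of 1 1 0 2 "a + 1" "- 1"] by simp_all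
  show r2: "quad \<rho> 0 0 1 \<in> totally_positive_units K"
    using square_in_units[OF quad_in_integers quad_in_integers r]
      quad_mult[OF root, of 0 1 0 0 1 0] by simp
  show s2: "quad \<rho> 1 2 1 \<in> totally_positive_units K"
    using square_in_units[OF quad_in_integers quad_in_integers s]
      quad_mult[OF root, of 1 1 0 1 1 0] by simp
  have r2': "quad \<rho> (- (a + 3)) (- a) 1 * quad \<rho> (- (a + 3)) (- a) 1 \<in> totally_positive_units K"
    using square_in_units[OF quad_in_integers quad_in_integers, of "- (a + 3)" "- a" 1 0 1 0] r
    by (simp add: mult.commute)
  have s2': "quad \<rho> 2 (a + 1) (- 1) * quad \<rho> 2 (a + 1) (- 1) \<in> totally_positive_units K"
    using square_in_units[OF quad_in_integers quad_in_integers, of 2 "a + 1" "- 1" 1 1 0] s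
    by (simp add: mult.commute)
  show "quad \<rho> 1 0 0 \<in> totally_positive_units K"
    using units_mult[OF r2 units_divide[OF r2]] unit_nonzero[OF r2] by simp
  show s2'': "quad \<rho> (2 - a) (- (a^2 + a + 1)) a \<in> totally_positive_units K"
    using s2' unfolding quad_mult[OF root]
    by (elim back_subst[of "\<lambda>t. t \<in> _"], intro arg_cong3[where f = "quad \<rho>"])
       (simp_all add: algebra_simps power2_eq_square)
  show "quad \<rho> (- (a + 1)) (- (a^2 + 3*a + 3)) (a + 2) \<in> totally_positive_units K"
    using units_mult[OF r2 s2''] unfolding quad_mult[OF root]
    by (elim back_subst[of "\<lambda>t. t \<in> _"], intro arg_cong3[where f = "quad \<rho>"])
       (simp_all add: algebra_simps power2_eq_square)
  show "quad \<rho> (a^2 + 3*a + 4) (a^2 + a + 1) (- (a + 1)) \<in> totally_positive_units K"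
    using units_mult[OF s2 r2'] unfolding quad_mult[OF root]
    by (elim back_subst[of "\<lambda>t. t \<in> _"], intro arg_cong3[where f = "quad \<rho>"])
       (simp_all add: algebra_simps power2_eq_square)
qed

section \<open>Conjugate roots and positive linear forms\<close>

text \<open>The Moebius map taking x to -1/(1 + x) has order three and permutes the roots of the
  cubic.\<close>

lemma conjugate_roots:
  shows "cubic_root a (- (1 + \<rho>) / \<rho>)" "cubic_root a (- 1 / (1 + \<rho>))"
proof -
  have cubic: "\<rho>^3 - of_int a * \<rho>^2 - (of_int a + 3) * \<rho> - 1 = 0"
    using root by (simp add: cubic_root_def)
  have cubic_root_divide: "cubic_root a (p / q)"
    if "q \<noteq> 0" "p^3 - of_int a * p^2 * q - (of_int a + 3) * p * q^2 - q^3 = 0" for p q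
  proof -
    have "q^3 * ((p / q)^3 - of_int a * (p / q)^2 - (of_int a + 3) * (p / q) - 1) =
      p^3 - of_int a * p^2 * q - (of_int a + 3) * p * q^2 - q^3"
      using that(1) by (simp add: field_simps power2_eq_square power3_eq_cube)
    then show ?thesis
      using that by (simp add: cubic_root_def)
  qed
  show "cubic_root a (- (1 + \<rho>) / \<rho>)"
    by (rule cubic_root_divide) (use root_pos in simp, use cubic in \<open>simp add: algebra_simps power2_eq_square power3_eq_cube\<close>)
  show "cubic_root a (- 1 / (1 + \<rho>))"
    by (rule cubic_root_divide) (use root_pos in simp, use cubic in \<open>simp add: algebra_simps power2_eq_square power3_eq_cube\<close>)
qed


lemma quad_divide:
  assumes "q \<noteq> 0"
  shows "q^2 * quad (p / q) x y z = of_int x * q^2 + of_int y * p * q + of_int z * p^2"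
proof -
  define t where "t = p / q"
  have "p = q * t" using assms by (simp add: t_def)
  then show ?thesis
    unfolding t_def[symmetric] by (simp add: quad_def power2_eq_square algebra_simps)
qed

lemma tot_pos_imp_pos:
  assumes "tot_pos x y z"
  shows "x + z > 0"
proof -
  let ?r = "- (1 + \<rho>) / \<rho>" and ?s = "- 1 / (1 + \<rho>)"
  have "quad r x y z > 0" if "cubic_root a r" for r
    using assms that by (simp add: tot_pos_def)
  note pos = this[OF root] this[OF conjugate_roots(1)] this[OF conjugate_roots(2)]
  have r: "\<rho>^2 * quad ?r x y z = of_int x * \<rho>^2 - of_int y * \<rho> * (1 + \<rho>) + of_int z * (1 + \<rho>)^2"
    using quad_divide[of \<rho> "- (1 + \<rho>)"] root_pos by (simp add: power2_eq_square algebra_simps)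
  have s: "(1 + \<rho>)^2 * quad ?s x y z = of_int x * (1 + \<rho>)^2 - of_int y * (1 + \<rho>) + of_int z"
    using quad_divide[of "1 + \<rho>" "- 1"] root_pos by simp
  \<comment> \<open>The weights, divided by \<open>(1 + \<rho> + \<rho>^2)^2\<close>, are the
    conjugates of the square of \<open>(1 + \<rho>) / (1 + \<rho> + \<rho>^2)\<close>. They sum to
    one, and \<open>y\<close> cancels.\<close>
  have "(1 + \<rho> + \<rho>^2)^2 * of_int (x + z) =
      (1 + \<rho>)^2 * quad \<rho> x y z + \<rho>^2 * quad ?r x y z + \<rho>^2 * ((1 + \<rho>)^2 * quad ?s x y z)"
    unfolding r s by (simp add: quad_def algebra_simps power2_eq_square)
  also have "\<dots> > 0"
    using pos root_pos by (intro add_pos_pos mult_pos_pos) auto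
  finally have "real_of_int (x + z) > 0"
    by (simp add: zero_less_mult_iff)
  then show ?thesis by linarith
qed

text \<open>Multiplications that lead across the walls other than \<open>y = 0\<close>: the first
  two for \<open>cone1\<close>, the last two for \<open>cone2\<close>.\<close>

lemma unit_steps:
  shows "quad \<rho> (- (a + 1)) (- (a^2 + 3*a + 3)) (a + 2) * quad \<rho> x y z =
    quad \<rho> (- a*x + a*y - a*z - x + 2*y - 3*z)
      (- (a^2)*x + a^2*y - a^2*z - 3*a*x + 4*a*y - 5*a*z - 3*x + 5*y - 7*z)
      (a*x - a*y + a*z + 2*x - 3*y + 5*z)"
    and "quad \<rho> (2 - a) (- (a^2 + a + 1)) a * quad \<rho> x y z =
    quad \<rho> (- a*x + a*y - a*z + 2*x - z)
      (- (a^2)*x + a^2*y - a^2*z - a*x + 2*a*y - 3*a*z - x + 2*y - 3*z)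
      (a*x - a*y + a*z - y + 2*z)"
    and "quad \<rho> (a^2 + 3*a + 4) (a^2 + a + 1) (- (a + 1)) * quad \<rho> x y z =
    quad \<rho> (a^2*x + 3*a*x - a*y + 4*x - y + z) (a^2*x + a*x - a*y + x + y + 2*z) (- a*x - x + y + z)"
    and "quad \<rho> 1 2 1 * quad \<rho> x y z =
    quad \<rho> (a*z + x + y + 2*z) (a^2*z + a*y + 5*a*z + 2*x + 4*y + 7*z)
      (a^2*z + a*y + 3*a*z + x + 2*y + 4*z)"
  unfolding quad_mult[OF root]
  by (intro arg_cong3[where f = "quad \<rho>"]; simp add: algebra_simps power2_eq_square)+

text \<open>Both forms are the form \<open>x + z\<close> evaluated after one of the first two
  multiplications in \<open>unit_steps\<close>.\<close>

lemma tot_pos_imp_pos':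
  assumes "tot_pos x y z"
  shows "x - y + 2*z > 0" "2*x - y + z > 0"
  using tot_pos_imp_pos[OF tot_pos_mult_unit[OF unit_elements(5) unit_steps(1) assms]]
    tot_pos_imp_pos[OF tot_pos_mult_unit[OF unit_elements(4) unit_steps(2) assms]] by simp_all


section \<open>Descent into two cones\<close>

text \<open>The index of the lattice spanned by the generators of the second cone.\<close>

definition D :: int where "D = a^2 + 3*a + 3"

lemma D_pos: "D > 0"
proof -
  have "D = (a + 1)^2 + (a + 1) + 1" by (simp add: D_def power2_eq_square algebra_simps)
  then show ?thesis using a_ge zero_le_power2[of "a + 1"] by linarith
qed

text \<open>
  The cones spanned by \<open>1, \<rho>\<^sup>2, (1 + \<rho>)\<^sup>2\<close> and by \<open>1, \<rho>\<^sup>2, \<rho>\<^sup>2 (1 + \<rho>)\<^sup>-\<^sup>2\<close>; the three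
  inequalities are the signs of the coordinates with respect to these generators.
\<close>

definition cone1 :: "int \<Rightarrow> int \<Rightarrow> int \<Rightarrow> bool" where
  "cone1 x y z \<longleftrightarrow> 0 \<le> y \<and> y \<le> 2 * x \<and> y \<le> 2 * z"

definition cone2 :: "int \<Rightarrow> int \<Rightarrow> int \<Rightarrow> bool" where
  "cone2 x y z \<longleftrightarrow> y \<le> 0 \<and> 0 \<le> D * x - (a + 1) * y \<and> 0 \<le> D * z + (a + 2) * y"

definition reducible :: "int \<Rightarrow> int \<Rightarrow> int \<Rightarrow> bool" where
  "reducible x y z \<longleftrightarrow> (\<exists>u \<in> totally_positive_units K. \<exists>x' y' z'.
     u * quad \<rho> x y z = quad \<rho> x' y' z' \<and> (cone1 x' y' z' \<or> cone2 x' y' z'))"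

lemma reducible_cone: "cone1 x y z \<or> cone2 x y z \<Longrightarrow> reducible x y z"
  unfolding reducible_def using unit_elements(1) by (intro bexI[of _ 1]) auto

lemma reducible_unit_step:
  assumes u: "u \<in> totally_positive_units K" "u * quad \<rho> x y z = quad \<rho> x' y' z'"
    and "reducible x' y' z'"
  shows "reducible x y z"
proof -
  obtain v x'' y'' z'' where v: "v \<in> totally_positive_units K"
    "v * quad \<rho> x' y' z' = quad \<rho> x'' y'' z''" "cone1 x'' y'' z'' \<or> cone2 x'' y'' z''"
    using assms(3) unfolding reducible_def by metis
  then have "(v * u) * quad \<rho> x y z = quad \<rho> x'' y'' z''"
    using u(2) by (simp add: mult.assoc)
  then show ?thesis
    unfolding reducible_def using units_mult[OF v(1) u(1)] v(3) by metis
qed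

text \<open>Both forms share the measure \<open>n\<close>. If an inequality of the relevant cone
  fails, the descent passes to the other form, at a unit multiple; the value changes by exactly the
  violated expression. The factor 2 on \<open>x + z\<close> makes the forms agree on the wall
  \<open>y = 0\<close>.\<close>

lemma tot_pos_reducible:
  assumes "tot_pos x y z" "int n = 2 * (x + z) \<or> int n = 2 * x - y + 2 * z"
  shows "reducible x y z"
  using assms
proof (induction n arbitrary: x y z rule: less_induct)
  case (less n)
  have step: "reducible x y z"
    if u: "u \<in> totally_positive_units K" "u * quad \<rho> x y z = quad \<rho> x' y' z'"
      and k: "k = 2 * (x' + z') \<or> k = 2 * x' - y' + 2 * z'" "k < int n" for u x' y' z' k
  proof (rule reducible_unit_step[OF u])
    have pos: "tot_pos x' y' z'"
      by (rule tot_pos_mult_unit[OF u less.prems(1)])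
    \<comment> \<open>Twice \<open>2 * x' - y' + 2 * z'\<close> is the sum of the three forms
      already known to be positive.\<close>
    then have "k > 0"
      using k(1) tot_pos_imp_pos[OF pos] tot_pos_imp_pos'[OF pos] by auto
    then show "reducible x' y' z'"
      using less.IH[of "nat k" x' y' z'] k pos by simp
  qed
  \<comment> \<open>Across the wall \<open>y = 0\<close> the element stays the same and only the
    form changes.\<close>
  have one: "1 \<in> totally_positive_units K"
    using unit_elements(1) by simp
  from less.prems(2) show ?case
  proof
    assume n: "int n = 2 * (x + z)"
    show ?case
    proof (cases "cone2 x y z")
      case False
      then consider "y > 0" | "D * x - (a + 1) * y < 0" | "D * z + (a + 2) * y < 0"
        by (auto simp: cone2_def)
      then show ?thesis
      proof cases
        case 1
        then show ?thesis by (intro step[OF one mult_1_left disjI2[OF refl]]) (simp add: n)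
      next
        case 2
        then show ?thesis
          by (intro step[OF unit_elements(6) unit_steps(3) disjI2[OF refl]])
            (simp add: n D_def algebra_simps)
      next
        case 3
        then show ?thesis
          by (intro step[OF unit_elements(3) unit_steps(4) disjI2[OF refl]])
            (simp add: n D_def algebra_simps)
      qed
    qed (simp add: reducible_cone)
  next
    assume n: "int n = 2 * x - y + 2 * z"
    show ?case
    proof (cases "cone1 x y z")
      case False
      then consider "y < 0" | "y > 2 * z" | "y > 2 * x"
        by (auto simp: cone1_def)
      then show ?thesis
      proof cases
        case 1
        then show ?thesis by (intro step[OF one mult_1_left disjI1[OF refl]]) (simp add: n)
      next
        case 2
        then show ?thesis
          by (intro step[OF unit_elements(5) unit_steps(1) disjI1[OF refl]])
            (simp add: n algebra_simps)
      next
        case 3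
        then show ?thesis
          by (intro step[OF unit_elements(4) unit_steps(2) disjI1[OF refl]])
            (simp add: n algebra_simps)
      qed
    qed (simp add: reducible_cone)
  qed
qed

section \<open>Total positivity on the cones\<close>

text \<open>A nonnegative combination is nonnegative at every root, and irreducibility excludes the
  value zero. The denominator \<open>d\<close> admits lattice points with fractional cone
  coordinates.\<close>

lemma tot_pos_cone:
  assumes e: "tot_pos x1 y1 z1" "tot_pos x2 y2 z2" "tot_pos x3 y3 z3"
    and "p \<ge> 0" "q \<ge> 0" "s \<ge> 0" "d > 0"
    and "d * x = p * x1 + q * x2 + s * x3" "d * y = p * y1 + q * y2 + s * y3"
      "d * z = p * z1 + q * z2 + s * z3"
    and nz: "x \<noteq> 0 \<or> y \<noteq> 0 \<or> z \<noteq> 0"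
  shows "tot_pos x y z"
  unfolding tot_pos_def
proof (intro allI impI)
  fix r assume r: "cubic_root a r"
  have "of_int d * quad r x y z =
      of_int p * quad r x1 y1 z1 + of_int q * quad r x2 y2 z2 + of_int s * quad r x3 y3 z3"
    using assms by (simp add: quad_scale quad_add)
  also have "\<dots> \<ge> 0"
    using e r \<open>p \<ge> 0\<close> \<open>q \<ge> 0\<close> \<open>s \<ge> 0\<close>
    by (intro add_nonneg_nonneg mult_nonneg_nonneg) (auto simp: tot_pos_def intro: less_imp_le)
  finally have "quad r x y z \<ge> 0"
    using \<open>d > 0\<close> by (simp add: zero_le_mult_iff)
  moreover have "quad r x y z \<noteq> 0"
    using quad_eq_0[OF r] nz by blast
  ultimately show "quad r x y z > 0" by simp
qed

lemma tot_pos_cone1: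
  assumes "cone1 x y z" "x \<noteq> 0 \<or> y \<noteq> 0 \<or> z \<noteq> 0"
  shows "tot_pos x y z"
  by (rule tot_pos_cone[OF tot_pos_unit tot_pos_unit tot_pos_unit, OF unit_elements(1,2,3),
        where p = "2 * x - y" and q = "2 * z - y" and s = y and d = 2])
     (use assms in \<open>auto simp: cone1_def\<close>)

lemma tot_pos_cone2:
  assumes "cone2 x y z" "x \<noteq> 0 \<or> y \<noteq> 0 \<or> z \<noteq> 0"
  shows "tot_pos x y z"
  by (rule tot_pos_cone[OF tot_pos_unit tot_pos_unit tot_pos_unit, OF unit_elements(1,2,5),
        where p = "D * x - (a + 1) * y" and q = "D * z + (a + 2) * y" and s = "- y" and d = D])
     (use assms D_pos in \<open>auto simp: cone2_def D_def algebra_simps\<close>)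

section \<open>Indecomposability of the representatives\<close>

lemma indecomposable_level_one:
  assumes "tot_pos x y z" "x + z = 1"
  shows "indecomposable K (quad \<rho> x y z)"
  unfolding indecomposable_quad
proof (intro conjI notI)
  assume "\<exists>x' y' z'. tot_pos x' y' z' \<and> tot_pos (x - x') (y - y') (z - z')"
  then obtain x' y' z' where "tot_pos x' y' z'" "tot_pos (x - x') (y - y') (z - z')" by blast
  from this[THEN tot_pos_imp_pos] show False using assms by linarith
qed fact

lemma indecomposable_exceptional: "indecomposable K (quad \<rho> 1 1 1)"
  unfolding indecomposable_quad
proof (intro conjI notI)
  show "tot_pos 1 1 1" by (rule tot_pos_cone1) (simp_all add: cone1_def)
  assume "\<exists>x y z. tot_pos x y z \<and> tot_pos (1 - x) (1 - y) (1 - z)"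
  then obtain x y z where *: "tot_pos x y z" "tot_pos (1 - x) (1 - y) (1 - z)" by blast
  \<comment> \<open>Each of the three forms is 2 on \<open>1 + \<rho> + \<rho>^2\<close>, so it is 1
    on both summands.\<close>
  have "x + z = 1" "x - y + 2 * z = 1" "2 * x - y + z = 1"
    using tot_pos_imp_pos[OF *(1)] tot_pos_imp_pos[OF *(2)]
      tot_pos_imp_pos'[OF *(1)] tot_pos_imp_pos'[OF *(2)]
    by simp_all
  then have "2 * x = 1" by linarith
  then show False by presburger
qed

section \<open>Lattice points of the second cone at level one\<close>

text \<open>Parametrizes the lattice points of \<open>cone2\<close> with \<open>x + z = 1\<close>
  other than the three generators.\<close>

definition triangle :: "int \<Rightarrow> int \<Rightarrow> bool" where
  "triangle v w \<longleftrightarrow> 0 \<le> v \<and> v \<le> a \<and> v * (a + 2) + 1 \<le> w \<and> w \<le> (v + 1) * (a + 1)"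

lemma triangle_cone2:
  assumes "triangle v w"
  shows "cone2 (- v) (- w) (v + 1)"
proof -
  \<comment> \<open>As \<open>(a + 1) * (a + 2) = D - 1\<close>, these factors turn the bounds on
    \<open>w\<close> into wall inequalities.\<close>
  have "(a + 1) * (v * (a + 2) + 1) \<le> (a + 1) * w" "(a + 2) * w \<le> (a + 2) * ((v + 1) * (a + 1))"
    using assms a_ge by (auto simp: triangle_def intro!: mult_left_mono)
  moreover have "0 \<le> v * (a + 2)" using assms a_ge by (simp add: triangle_def)
  then have "w \<ge> 0" using assms unfolding triangle_def by linarith
  ultimately show ?thesis
    using assms by (simp add: triangle_def cone2_def D_def algebra_simps power2_eq_square)
qed

lemma triangle_tot_pos:
  assumes "triangle v w"
  shows "tot_pos (- v) (- w) (v + 1)"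
  using tot_pos_cone2[OF triangle_cone2[OF assms]] by auto

text \<open>Since \<open>D = (a + 1) * (a + 2) + 1\<close>, the wall inequalities give the bounds on
  \<open>w\<close> up to an error below one, and integrality does the rest. The strict bounds
  exclude the generators.\<close>

lemma level_one_triangle:
  assumes "x + z = 1" "- y < D" "0 \<le> - y"
    and "0 \<le> D * x - (a + 1) * y" "D * x - (a + 1) * y < D"
    and "0 \<le> D * z + (a + 2) * y" "D * z + (a + 2) * y < D"
  shows "triangle (- x) (- y)"
proof -
  define v w where "v = - x" and "w = - y"
  have xyz: "x = - v" "y = - w" "z = v + 1" using assms(1) by (simp_all add: v_def w_def)
  have w: "0 \<le> w" "w < D"
    and h: "D * v \<le> (a + 1) * w" "(a + 1) * w < D * (v + 1)"
      "(a + 2) * w \<le> D * (v + 1)" "D * v < (a + 2) * w"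
    using assms(2-) by (simp_all add: xyz algebra_simps)
  have D: "D = (a + 1) * (a + 2) + 1" by (simp add: D_def algebra_simps power2_eq_square)
  have "a \<noteq> - 1"
    \<comment> \<open>For \<open>a = -1\<close> one has \<open>D = 1\<close>, and no lattice point
      satisfies the strict bounds.\<close>
    using w h by (auto simp: D)
  then have a: "a \<ge> 0" using a_ge by simp
  have "0 < D * (v + 1)"
    using h(2) a w(1) by (smt (verit) mult_nonneg_nonneg)
  then have v: "0 \<le> v" using D_pos by (simp add: zero_less_mult_iff)
  have "(a + 1) * w < (a + 1) * D" using w a by simp
  then have "D * v < D * (a + 1)" using h(1) by (simp add: mult.commute)
  then have va: "v \<le> a" using D_pos by simp
  have "0 < (a + 2) * w" using h(4) v D_pos by (smt (verit) mult_nonneg_nonneg)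
  then have "0 < w" using a by (simp add: zero_less_mult_iff)
  have le: "v \<le> (a + 1) * (w - v * (a + 2))"
    using h(1) by (simp add: D algebra_simps)
  then have "0 \<le> w - v * (a + 2)" using v a by (smt (verit) mult_pos_neg)
  moreover have "w - v * (a + 2) \<noteq> 0" using le v \<open>0 < w\<close> by auto
  ultimately have lower: "v * (a + 2) + 1 \<le> w" by simp
  have "(a + 2) * (w - (v + 1) * (a + 1)) \<le> v + 1"
    using h(3) by (simp add: D algebra_simps)
  also have "\<dots> < (a + 2) * 1" using va by simp
  finally have "w - (v + 1) * (a + 1) < 1" using a by (subst (asm) mult_less_cancel_left) simp
  then show ?thesis
    using v va lower by (simp add: triangle_def v_def[symmetric] w_def[symmetric])
qed

section \<open>Indecomposables in the two cones\<close>

lemma indecomposable_minus: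
  assumes "indecomposable K (quad \<rho> x y z)" "tot_pos x' y' z'"
  shows "\<not> tot_pos (x - x') (y - y') (z - z')"
  using assms by (auto simp: indecomposable_quad)

text \<open>If a cone coordinate is at least one, its generator can be subtracted within the cone,
  so the element equals that generator. Otherwise index 2 leaves zero and half the sum of the
  generators, \<open>1 + \<rho> + \<rho>^2\<close>.\<close>

lemma indecomposable_cone1:
  assumes ind: "indecomposable K (quad \<rho> x y z)" and cone: "cone1 x y z"
  shows "quad \<rho> x y z \<in> totally_positive_units K \<or> quad \<rho> x y z = quad \<rho> 1 1 1"
proof -
  have minus: "x = x' \<and> y = y' \<and> z = z'"
    if "quad \<rho> x' y' z' \<in> totally_positive_units K" "cone1 (x - x') (y - y') (z - z')" for x' y' z'
    using tot_pos_cone1[OF that(2)] indecomposable_minus[OF ind tot_pos_unit[OF that(1)]] by auto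
  consider "y \<ge> 2" | "y \<le> 1" "2 * x - y \<ge> 2" | "y \<le> 1" "2 * z - y \<ge> 2"
    | "y \<le> 1" "2 * x - y \<le> 1" "2 * z - y \<le> 1"
    by linarith
  then show ?thesis
  proof cases
    case 1
    then show ?thesis using minus[OF unit_elements(3)] cone unit_elements(3) by (auto simp: cone1_def)
  next
    case 2
    then show ?thesis using minus[OF unit_elements(1)] cone unit_elements(1) by (auto simp: cone1_def)
  next
    case 3
    then show ?thesis using minus[OF unit_elements(2)] cone unit_elements(2) by (auto simp: cone1_def)
  next
    case 4
    then consider "x = 0" "y = 0" "z = 0" | "x = 1" "y = 1" "z = 1"
      using cone unfolding cone1_def by linarith
    then show ?thesis
    proof cases
      case 1
      then have "tot_pos 0 0 0" using ind unfolding indecomposable_quad by simp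
      then show ?thesis using root by (auto simp: tot_pos_def)
    qed simp
  qed
qed

text \<open>For a nonunit no generator can be subtracted within the cone, so the coordinates scaled
  by \<open>D\<close> are below \<open>D\<close>. They sum to \<open>D * (x + z)\<close>, so the
  level is 1 or 2; level 2 always decomposes.\<close>

lemma indecomposable_cone2:
  assumes ind: "indecomposable K (quad \<rho> x y z)" and cone: "cone2 x y z"
  shows "quad \<rho> x y z \<in> totally_positive_units K \<or>
    (\<exists>v w. triangle v w \<and> quad \<rho> x y z = quad \<rho> (- v) (- w) (v + 1))"
proof (cases "quad \<rho> x y z \<in> totally_positive_units K")
  case False
  have minus: "\<not> cone2 (x - x') (y - y') (z - z')"
    if "quad \<rho> x' y' z' \<in> totally_positive_units K" for x' y' z'
  proof
    assume *: "cone2 (x - x') (y - y') (z - z')"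
    then have "x = x' \<and> y = y' \<and> z = z'"
      using tot_pos_cone2[OF *] indecomposable_minus[OF ind tot_pos_unit[OF that]] by auto
    then show False using False that by simp
  qed
  have y: "0 \<le> - y" and nonneg: "0 \<le> D * x - (a + 1) * y" "0 \<le> D * z + (a + 2) * y"
    using cone by (simp_all add: cone2_def)
  have less: "- y < D" "D * x - (a + 1) * y < D" "D * z + (a + 2) * y < D"
    using minus[OF unit_elements(1)] minus[OF unit_elements(2)] minus[OF unit_elements(5)] y nonneg
    by (auto simp: cone2_def D_def algebra_simps power2_eq_square)
  have sum: "(D * x - (a + 1) * y) + (D * z + (a + 2) * y) + (- y) = D * (x + z)"
    by (simp add: algebra_simps)
  have "x + z > 0"
    using ind tot_pos_imp_pos unfolding indecomposable_quad by blast
  moreover have "D * (x + z) < D * 3"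
    using less sum by linarith
  then have "x + z < 3" using D_pos by simp
  ultimately consider "x + z = 1" | "x + z = 2" by linarith
  then show ?thesis
  proof cases
    case 1
    then have "triangle (- x) (- y)"
      using y nonneg less by (intro level_one_triangle)
    moreover have "z = - x + 1" using 1 by simp
    ultimately show ?thesis by (intro disjI2 exI[of _ "- x"] exI[of _ "- y"]) simp
  next
    case 2
    text \<open>Reflecting in the sum of the three generators of the cone leads back to level one.\<close>
    define x' y' z' where "x' = - a - x" and "y' = - D - y" and "z' = a + 3 - z"
    have sum2: "(D * x - (a + 1) * y) + (D * z + (a + 2) * y) + (- y) = D + D"
      using sum 2 by simp
    have p: "D * x' - (a + 1) * y' = D - (D * x - (a + 1) * y)"
      and q: "D * z' + (a + 2) * y' = D - (D * z + (a + 2) * y)"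
      by (simp_all add: x'_def y'_def z'_def algebra_simps)
    have "triangle (- x') (- y')"
    proof (rule level_one_triangle)
      show "x' + z' = 1" using 2 by (simp add: x'_def z'_def)
    qed (use less sum2 y in \<open>simp_all add: p q, simp_all add: y'_def\<close>)
    moreover define v w where "v = - x'" and "w = - y'"
    ultimately have t: "0 \<le> v" "v \<le> a" "v * (a + 2) + 1 \<le> w" "w \<le> (v + 1) * (a + 1)"
      by (simp_all add: triangle_def)
    \<comment> \<open>The two summands: the first has the largest second parameter allowed for
      \<open>a - v\<close>, and the remainder has first parameter 0.\<close>
    have "triangle (a - v) (1 + v + (a + 2) * (a - v))" "triangle 0 (a + 2 + (a + 1) * v - w)"
      using t by (simp_all add: triangle_def algebra_simps)
    note tp = this[THEN triangle_tot_pos]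
    have "x - (- (a - v)) = - 0" "z - (a - v + 1) = 0 + 1"
      "y - (- (1 + v + (a + 2) * (a - v))) = - (a + 2 + (a + 1) * v - w)"
      using 2 by (simp_all add: v_def w_def x'_def y'_def D_def algebra_simps power2_eq_square)
    then have "tot_pos (x - (- (a - v))) (y - (- (1 + v + (a + 2) * (a - v)))) (z - (a - v + 1))"
      using tp(2) by (simp only:)
    then show ?thesis
      using indecomposable_minus[OF ind tp(1)] by blast
  qed
qed simp

section \<open>Assembling the classification\<close>

lemma representatives_eq:
  "simplest_cubic_representatives a \<rho> =
    {quad \<rho> 1 0 0, quad \<rho> 1 1 1} \<union> {quad \<rho> (- v) (- w) (v + 1) | v w. triangle v w}"
  by (auto simp: simplest_cubic_representatives_def quad_def triangle_def)

lemma representatives_indecomposable: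
  assumes "\<epsilon> \<in> simplest_cubic_representatives a \<rho>"
  shows "indecomposable K \<epsilon>"
  using assms indecomposable_exceptional indecomposable_level_one[OF tot_pos_unit[OF unit_elements(1)]]
    indecomposable_level_one[OF triangle_tot_pos]
  by (auto simp: representatives_eq)

lemma indecomposable_representative:
  assumes "indecomposable K \<alpha>"
  shows "\<exists>\<epsilon> \<in> simplest_cubic_representatives a \<rho>. \<exists>u \<in> totally_positive_units K. \<alpha> = \<epsilon> * u"
proof -
  obtain x y z where \<alpha>: "\<alpha> = quad \<rho> x y z" and pos: "tot_pos x y z"
    using assms totally_positive_integers_iff unfolding indecomposable_def by blast
  have "reducible x y z"
    using tot_pos_imp_pos[OF pos] tot_pos_reducible[OF pos, of "nat (2 * (x + z))"] by simp
  then obtain u x' y' z' where u: "u \<in> totally_positive_units K" "u * \<alpha> = quad \<rho> x' y' z'"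
    and cone: "cone1 x' y' z' \<or> cone2 x' y' z'"
    unfolding reducible_def \<alpha> by blast
  have "indecomposable K (quad \<rho> x' y' z')"
    using indecomposable_mult_unit[OF assms u(1)] u(2) by simp
  then consider "u * \<alpha> \<in> totally_positive_units K" | "u * \<alpha> \<in> simplest_cubic_representatives a \<rho>"
    using cone indecomposable_cone1 indecomposable_cone2 unfolding u(2) representatives_eq by blast
  then show ?thesis
  proof cases
    case 1
    have "\<alpha> = 1 * ((u * \<alpha>) * (1 / u))" using unit_nonzero[OF u(1)] by simp
    moreover have "1 \<in> simplest_cubic_representatives a \<rho>" by (simp add: representatives_eq)
    ultimately show ?thesis using units_mult[OF 1 units_divide[OF u(1)]] by blast
  next
    case 2
    have "\<alpha> = (u * \<alpha>) * (1 / u)" using unit_nonzero[OF u(1)] by simp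
    then show ?thesis using 2 units_divide[OF u(1)] by blast
  qed
qed

end

theorem theorem1p2:
  fixes a :: int and \<rho> :: real and K :: "real set"
  assumes a: "a \<ge> -1"
    and root: "\<rho>^3 - of_int a * \<rho>^2 - (of_int a + 3) * \<rho> - 1 = 0"
    and largest: "\<And>x :: real. x^3 - of_int a * x^2 - (of_int a + 3) * x - 1 = 0 \<Longrightarrow> x \<le> \<rho>"
    and K: "K = generate_field real_ring {\<rho>}"
    and maximal_order: "ring_of_integers K = generate_ring real_ring {\<rho>}"
  shows "(\<forall>\<epsilon> \<in> simplest_cubic_representatives a \<rho>. indecomposable K \<epsilon>) \<and>
         (\<forall>\<alpha>. indecomposable K \<alpha> \<longrightarrow>
            (\<exists>\<epsilon> \<in> simplest_cubic_representatives a \<rho>.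
               \<exists>u \<in> totally_positive_units K. \<alpha> = \<epsilon> * u))"
proof -
  define f where "f = (\<lambda>x::real. x^3 - of_int a * x^2 - (of_int a + 3) * x - 1)"
  \<comment> \<open>A sign change between 0 and \<open>a + 3\<close> produces a positive root, so
    the largest root is positive.\<close>
  have "f (of_int a + 3) = 2 * (of_int a + 3)^2 - 1"
    by (simp add: f_def algebra_simps power2_eq_square power3_eq_cube)
  moreover have "(1::real) \<le> (of_int a + 3)^2"
    using a by (intro one_le_power) linarith
  ultimately have "0 \<le> f (of_int a + 3)" by linarith
  moreover have "f 0 \<le> 0" by (simp add: f_def)
  moreover have "continuous_on {0..of_int a + 3} f"
    unfolding f_def by (intro continuous_intros)
  moreover have "0 \<le> real_of_int a + 3" using a by linarith
  ultimately obtain x where x: "0 \<le> x" "f x = 0"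
    using IVT'[of f 0 0 "of_int a + 3"] by blast
  then have "x \<noteq> 0" by (auto simp: f_def)
  then have "\<rho> > 0"
    using largest[of x] x by (simp add: f_def)
  then interpret simplest_cubic_field a \<rho> K
    using assms by unfold_locales (simp_all add: cubic_root_def)
  show ?thesis
    using representatives_indecomposable indecomposable_representative by blast
qed

end
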